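(* For each $n\ge 2$ let $P_n$ be the path graph on $n$ vertices and let $dp(P_n,2)$ be the number of (unordered) partitions $\{A,B\}$ of $V(P_n)$ into exactly two dominating sets of $P_n$. Then $$\lim_{n\to\infty}\frac{dp(P_{n+1},2)}{dp(P_n,2)}=\phi,\qquad\text{where } \phi=\frac{1+\sqrt5}{2}.$$
   Context: A set $S\subseteq V(G)$ is a dominating set of a graph $G$ if every vertex in $V(G)\setminus S$ has at least one neighbor in $S$. A domatic partition of $G$ is a partition $\{V_1,\dots,V_k\}$ of $V(G)$ (unordered, into nonempty parts) such that every $V_i$ is a dominating set of $G$; its cardinality is $k$. The number $dp(G,i)$ is the number of domatic partitions of $G$ of cardinality $i$. The path $P_n$ has vertices $v_1,\dots,v_n$ and edges $\{v_j,v_{j+1}\}$ for $1\le j\le n-1$. *)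

theory Defs
  imports Complex_Main "HOL-Library.Disjoint_Sets" "Graph_Theory.Pair_Digraph"
begin

text \<open>Graphs are symmetric digraphs, so the direction of the arc below is immaterial.\<close>

definition dominating_set :: "('a, 'b) pre_digraph \<Rightarrow> 'a set \<Rightarrow> bool" where
  "dominating_set G S \<longleftrightarrow>
     S \<subseteq> verts G \<and> (\<forall>v \<in> verts G - S. \<exists>u \<in> S. v \<rightarrow>\<^bsub>G\<^esub> u)"

text \<open>Since \<^const>\<open>partition_on\<close> demands nonempty parts, a set of sets suffices.\<close>

definition domatic_partition :: "('a, 'b) pre_digraph \<Rightarrow> 'a set set \<Rightarrow> bool" where
  "domatic_partition G P \<longleftrightarrow>
     partition_on (verts G) P \<and> (\<forall>S \<in> P. dominating_set G S)"

definition dp :: "('a, 'b) pre_digraph \<Rightarrow> nat \<Rightarrow> nat" where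
  "dp G i = card {P. domatic_partition G P \<and> card P = i}"

text \<open>An undirected edge is represented by its two opposite arcs; the vertex \<open>v\<^sub>j\<close> is \<open>j\<close>.\<close>

definition path_graph :: "nat \<Rightarrow> nat pair_pre_digraph" where
  "path_graph n =
     \<lparr> pverts = {1..n},
       parcs = {(j, j + 1) |j. 1 \<le> j \<and> j < n} \<union> {(j + 1, j) |j. 1 \<le> j \<and> j < n} \<rparr>"

lemma pair_graph_path_graph: "pair_graph (path_graph n)"
proof
  have *: "parcs (path_graph n) \<subseteq> {1..n} \<times> {1..n}"
    by (auto simp: path_graph_def)
  then show "finite (parcs (path_graph n))"
    by (rule finite_subset) simp
qed (auto simp: path_graph_def symmetric_def arcs_ends_def arc_to_ends_def sym_def)

text \<open>As \<^const>\<open>card\<close> is 0 on infinite sets, \<^const>\<open>dp\<close> is meant for finite graphs only.\<close>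

lemma finite_domatic_partitions:
  assumes "finite (verts G)"
  shows "finite {P. domatic_partition G P \<and> card P = i}"
  by (rule finite_subset[of _ "Pow (Pow (verts G))"])
     (use assms in \<open>auto simp: domatic_partition_def partition_on_def\<close>)

end

theory Submission
  imports Defs "HOL-Number_Theory.Fib"
begin

text \<open>
  A partition of a graph into two dominating sets is a two-colouring in which every vertex has a
  neighbour of the other colour. On a path with at least two vertices this says that the maximal
  monochromatic stretches have length at most 2, and that the first and the last one have length 1.
  Consider such a colouring of \<open>P\<^bsub>m+2\<^esub>\<close>, where \<open>m \<ge> 1\<close>. If the next-to-last stretch has length 1,
  deleting the last vertex leaves a colouring of the same kind; if it has length 2, deleting the
  last two vertices does. Both steps can be undone in exactly one way, so that the numbers of these
  colourings satisfy the Fibonacci recurrence (\<open>card_colourings_rec\<close>). The colour of the first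
  vertex being fixed, \<open>P\<^sub>1\<close> has no such colouring and \<open>P\<^sub>2\<close> has one; hence \<open>dp(P\<^bsub>n+1\<^esub>, 2)\<close> is the
  \<open>n\<close>-th Fibonacci number (\<open>dp_path_graph\<close>), and the limit is that of the ratio of consecutive
  Fibonacci numbers (\<open>fib_ratio_tendsto\<close>).
\<close>

text \<open>
  Distinguishing the part that contains a chosen vertex \<open>x\<close> turns unordered pairs into single sets.
  Both parts are then automatically nonempty: one contains \<open>x\<close>, and the other dominates \<open>x\<close>.
\<close>

lemma dp_2_eq_card_sets:
  assumes x: "x \<in> verts G"
  shows "dp G 2 = card {A. x \<in> A \<and> dominating_set G A \<and> dominating_set G (verts G - A)}"
    (is "_ = card ?S")
proof -
  let ?P = "{P. domatic_partition G P \<and> card P = 2}"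
  have "bij_betw (\<lambda>A. {A, verts G - A}) ?S ?P"
  proof (rule bij_betw_imageI)
    show "inj_on (\<lambda>A. {A, verts G - A}) ?S"
      by (rule inj_onI) (auto simp: doubleton_eq_iff)
  next
    show "(\<lambda>A. {A, verts G - A}) ` ?S = ?P"
    proof (intro subset_antisym subsetI)
      fix P assume "P \<in> (\<lambda>A. {A, verts G - A}) ` ?S"
      then obtain A where A: "x \<in> A" "dominating_set G A" "dominating_set G (verts G - A)"
        and P: "P = {A, verts G - A}" by blast
      have sub: "A \<subseteq> verts G" using A(2) by (simp add: dominating_set_def)
      have ne: "verts G - A \<noteq> {}"
        using A(1,3) x unfolding dominating_set_def by blast
      have "partition_on (verts G) P"
        unfolding P by (rule partition_onI) (use sub ne A(1) in \<open>auto simp: disjnt_def\<close>)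
      moreover have "card P = 2"
        unfolding P using A(1) by (auto simp: card_2_iff)
      ultimately show "P \<in> ?P"
        using A(2,3) by (simp add: domatic_partition_def P)
    next
      fix P assume "P \<in> ?P"
      then have part: "partition_on (verts G) P" and dom: "\<forall>S\<in>P. dominating_set G S"
        and "card P = 2"
        by (auto simp: domatic_partition_def)
      obtain A where A: "A \<in> P" "x \<in> A"
        using x partition_onD1[OF part] by blast
      obtain B where P: "P = {A, B}" and "A \<noteq> B"
        using \<open>card P = 2\<close> A(1) unfolding card_2_iff by (metis insert_commute insertE singletonD)
      have "A \<inter> B = {}"
        using partition_onD2[OF part] \<open>A \<noteq> B\<close> unfolding P by (auto simp: disjoint_def)
      then have "B = verts G - A"
        using partition_onD1[OF part] unfolding P by auto
      then show "P \<in> (\<lambda>A. {A, verts G - A}) ` ?S"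
        using A dom P by auto
    qed
  qed
  then show ?thesis
    by (simp add: dp_def bij_betw_same_card)
qed

text \<open>
  A colouring is given by the set \<open>A\<close> of the vertices of one colour. Neighbours outside \<open>{1..n}\<close> do
  not count, so that the condition also makes sense for the restriction to a shorter path of a set
  \<open>A\<close> of vertices of a longer one.
\<close>

definition sees_both_colours :: "nat \<Rightarrow> nat set \<Rightarrow> bool" where
  "sees_both_colours n A \<longleftrightarrow>
     (\<forall>v \<in> {1..n}. v < n \<and> (v \<in> A) \<noteq> (Suc v \<in> A) \<or> 1 < v \<and> (v \<in> A) \<noteq> (v - 1 \<in> A))"

definition colourings :: "nat \<Rightarrow> nat set set" where
  "colourings n = {A. A \<subseteq> {1..n} \<and> 1 \<in> A \<and> sees_both_colours n A}"

lemma arc_path_graph_iff: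
  "v \<rightarrow>\<^bsub>with_proj (path_graph n)\<^esub> u \<longleftrightarrow>
     (1 \<le> v \<and> v < n \<and> u = Suc v) \<or> (1 < v \<and> v \<le> n \<and> u = v - 1)"
  by (auto simp: path_graph_def arcs_ends_conv)

lemma dominating_sets_path_graph_iff:
  "dominating_set (path_graph n) A \<and> dominating_set (path_graph n) ({1..n} - A) \<longleftrightarrow>
     A \<subseteq> {1..n} \<and> sees_both_colours n A"
proof (cases "A \<subseteq> {1..n}")
  case True
  have V: "verts (with_proj (path_graph n)) = {1..n}"
    by (simp add: path_graph_def)
  have sub: "{1..n} - ({1..n} - A) = A" using True by blast
  have 1: "dominating_set (path_graph n) A \<longleftrightarrow>
      (\<forall>v \<in> {1..n} - A. v < n \<and> Suc v \<in> A \<or> 1 < v \<and> v - 1 \<in> A)"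
    unfolding dominating_set_def V arc_path_graph_iff using True by auto
  have 2: "dominating_set (path_graph n) ({1..n} - A) \<longleftrightarrow>
      (\<forall>v \<in> A. v < n \<and> Suc v \<notin> A \<or> 1 < v \<and> v - 1 \<notin> A)"
    unfolding dominating_set_def V arc_path_graph_iff sub using True by fastforce
  show ?thesis
    unfolding 1 2 sees_both_colours_def using True by blast
next
  case False
  then show ?thesis by (simp add: dominating_set_def path_graph_def)
qed

lemma dp_path_graph_eq_card_colourings:
  assumes "1 \<le> n"
  shows "dp (path_graph n) 2 = card (colourings n)"
proof -
  have V: "verts (with_proj (path_graph n)) = {1..n}"
    by (simp add: path_graph_def)
  have "1 \<in> verts (with_proj (path_graph n))"
    using assms V by simp
  from dp_2_eq_card_sets[OF this] show ?thesis
    unfolding V dominating_sets_path_graph_iff colourings_def by (simp add: conj_left_commute)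
qed

lemma sees_both_colours_last:
  assumes "sees_both_colours n A" "1 \<le> n"
  shows "1 < n" "(n \<in> A) \<noteq> (n - 1 \<in> A)"
  using assms unfolding sees_both_colours_def by force+

lemma sees_both_colours_Int:
  assumes "n \<le> k"
  shows "sees_both_colours n (A \<inter> {1..k}) \<longleftrightarrow> sees_both_colours n A"
  unfolding sees_both_colours_def using assms by (intro ball_cong) auto

text \<open>
  The last vertex can only rely on its predecessor. What remains depends on whether vertex \<open>m + 1\<close>
  is a stretch of its own: if it is not, it relies on vertex \<open>m + 2\<close> for the other colour, and
  vertex \<open>m\<close> must find the other colour to its left.
\<close>

lemma sees_both_colours_Suc_Suc:
  assumes "1 \<le> m"
  shows "sees_both_colours (Suc (Suc m)) A \<longleftrightarrow>
     (Suc (Suc m) \<in> A) \<noteq> (Suc m \<in> A) \<and>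
     (if (Suc m \<in> A) = (m \<in> A) then sees_both_colours m A else sees_both_colours (Suc m) A)"
proof -
  let ?ok = "\<lambda>v. (v \<in> A) \<noteq> (Suc v \<in> A) \<or> 1 < v \<and> (v \<in> A) \<noteq> (v - 1 \<in> A)"
  have last: "sees_both_colours k A \<longleftrightarrow>
      (\<forall>v\<in>{1..<k}. ?ok v) \<and> 1 < k \<and> (k \<in> A) \<noteq> (k - 1 \<in> A)" if "1 \<le> k" for k
  proof -
    have "{1..k} = insert k {1..<k}" using that by auto
    then show ?thesis unfolding sees_both_colours_def by auto
  qed
  have m1: "{1..<Suc m} = insert m {1..<m}"
    and m2: "{1..<Suc (Suc m)} = insert (Suc m) (insert m {1..<m})"
    using assms by auto
  define Q where "Q \<longleftrightarrow> (\<forall>v\<in>{1..<m}. ?ok v)"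
  have 0: "sees_both_colours m A \<longleftrightarrow> Q \<and> 1 < m \<and> (m \<in> A) \<noteq> (m - 1 \<in> A)"
    unfolding last[OF assms] Q_def ..
  have 1: "sees_both_colours (Suc m) A \<longleftrightarrow> Q \<and> (Suc m \<in> A) \<noteq> (m \<in> A)"
    using assms unfolding last[of "Suc m", OF le_SucI[OF assms]] m1 Q_def ball_simps by auto
  have 2: "sees_both_colours (Suc (Suc m)) A \<longleftrightarrow>
      Q \<and> ?ok m \<and> ?ok (Suc m) \<and> (Suc (Suc m) \<in> A) \<noteq> (Suc m \<in> A)"
    unfolding last[of "Suc (Suc m)", OF le_SucI[OF le_SucI[OF assms]]] m2 Q_def ball_simps by auto
  show ?thesis
    unfolding 0 1 2 by auto
qed

lemma finite_colourings: "finite (colourings n)"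
  by (rule finite_subset[of _ "Pow {1..n}"]) (auto simp: colourings_def)

text \<open>
  The two summands count the colourings whose next-to-last stretch has length 1 and 2. Deleted
  vertices are put back with the only admissible colours: vertex \<open>m + 2\<close> gets the colour opposite
  to that of \<open>m + 1\<close>, which in the second case has the colour of \<open>m\<close>.
\<close>

lemma card_colourings_rec:
  assumes m: "1 \<le> m"
  shows "card (colourings (Suc (Suc m))) = card (colourings (Suc m)) + card (colourings m)"
proof -
  let ?C = "colourings (Suc (Suc m))"
  let ?C1 = "{A \<in> ?C. (Suc m \<in> A) \<noteq> (m \<in> A)}"
  let ?C2 = "{A \<in> ?C. (Suc m \<in> A) = (m \<in> A)}"
  let ?f1 = "\<lambda>A. if Suc m \<in> A then A else insert (Suc (Suc m)) A"
  let ?f2 = "\<lambda>A. if m \<in> A then insert (Suc m) A else insert (Suc (Suc m)) A"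
  have ivl: "{1..Suc k} = insert (Suc k) {1..k}" for k
    by auto
  have Int1: "A \<inter> {1..Suc m} = A - {Suc (Suc m)}" if "A \<subseteq> {1..Suc (Suc m)}" for A
    using that by (auto simp: ivl)
  have Int2: "A \<inter> {1..m} = A - {Suc m, Suc (Suc m)}" if "A \<subseteq> {1..Suc (Suc m)}" for A
    using that by (auto simp: ivl)
  have f1_Int: "?f1 A \<inter> {1..Suc m} = A" if "A \<subseteq> {1..Suc m}" for A
    using that by (auto simp: ivl)
  have f2_Int: "?f2 A \<inter> {1..m} = A" if "A \<subseteq> {1..m}" for A
    using that by (auto simp: ivl)
  have "bij_betw (\<lambda>A. A \<inter> {1..Suc m}) ?C1 (colourings (Suc m))"
  proof (rule bij_betw_byWitness[where f' = ?f1])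
    show "\<forall>A\<in>?C1. ?f1 (A \<inter> {1..Suc m}) = A"
    proof
      fix A assume "A \<in> ?C1"
      then have A: "A \<subseteq> {1..Suc (Suc m)}" "(Suc (Suc m) \<in> A) \<noteq> (Suc m \<in> A)"
          "(Suc m \<in> A) \<noteq> (m \<in> A)"
        using m by (auto simp: colourings_def sees_both_colours_Suc_Suc)
      then show "?f1 (A \<inter> {1..Suc m}) = A"
        unfolding Int1[OF A(1)] by auto
    qed
    show "\<forall>B\<in>colourings (Suc m). ?f1 B \<inter> {1..Suc m} = B"
      using f1_Int by (simp add: colourings_def)
    show "(\<lambda>A. A \<inter> {1..Suc m}) ` ?C1 \<subseteq> colourings (Suc m)"
      using m by (auto simp: colourings_def sees_both_colours_Suc_Suc
          sees_both_colours_Int[simplified])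
    show "?f1 ` colourings (Suc m) \<subseteq> ?C1"
    proof (rule image_subsetI)
      fix B assume "B \<in> colourings (Suc m)"
      then have B: "B \<subseteq> {1..Suc m}" "1 \<in> B" "sees_both_colours (Suc m) B"
        by (auto simp: colourings_def)
      have "sees_both_colours (Suc m) (?f1 B)"
        using B(3) sees_both_colours_Int[of "Suc m" "Suc m" "?f1 B"] f1_Int[OF B(1)] by simp
      moreover have "Suc (Suc m) \<notin> B" using B(1) by auto
      moreover have "(Suc m \<in> B) \<noteq> (m \<in> B)"
        using sees_both_colours_last[OF B(3)] by simp
      ultimately show "?f1 B \<in> ?C1"
        using B m by (auto simp: colourings_def sees_both_colours_Suc_Suc)
    qed
  qed
  then have "card ?C1 = card (colourings (Suc m))" by (rule bij_betw_same_card)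
  moreover
  have "bij_betw (\<lambda>A. A \<inter> {1..m}) ?C2 (colourings m)"
  proof (rule bij_betw_byWitness[where f' = ?f2])
    show "\<forall>A\<in>?C2. ?f2 (A \<inter> {1..m}) = A"
    proof
      fix A assume "A \<in> ?C2"
      then have A: "A \<subseteq> {1..Suc (Suc m)}" "(Suc (Suc m) \<in> A) \<noteq> (Suc m \<in> A)"
          "(Suc m \<in> A) = (m \<in> A)"
        using m by (auto simp: colourings_def sees_both_colours_Suc_Suc)
      then show "?f2 (A \<inter> {1..m}) = A"
        unfolding Int2[OF A(1)] by auto
    qed
    show "\<forall>B\<in>colourings m. ?f2 B \<inter> {1..m} = B"
      using f2_Int by (simp add: colourings_def)
    show "(\<lambda>A. A \<inter> {1..m}) ` ?C2 \<subseteq> colourings m"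
      using m by (auto simp: colourings_def sees_both_colours_Suc_Suc
          sees_both_colours_Int[simplified])
    show "?f2 ` colourings m \<subseteq> ?C2"
    proof (rule image_subsetI)
      fix B assume "B \<in> colourings m"
      then have B: "B \<subseteq> {1..m}" "1 \<in> B" "sees_both_colours m B"
        by (auto simp: colourings_def)
      have "sees_both_colours m (?f2 B)"
        using B(3) sees_both_colours_Int[of m m "?f2 B"] f2_Int[OF B(1)] by simp
      moreover have "Suc m \<notin> B" "Suc (Suc m) \<notin> B" using B(1) by auto
      ultimately show "?f2 B \<in> ?C2"
        using B m by (auto simp: colourings_def sees_both_colours_Suc_Suc)
    qed
  qed
  then have "card ?C2 = card (colourings m)" by (rule bij_betw_same_card)
  moreover have "card ?C = card ?C1 + card ?C2"
  proof -
    have "?C = ?C1 \<union> ?C2" by blast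
    moreover have "card (?C1 \<union> ?C2) = card ?C1 + card ?C2"
      by (rule card_Un_disjoint) (auto simp: finite_colourings)
    ultimately show ?thesis by simp
  qed
  ultimately show ?thesis by simp
qed

lemma card_colourings: "card (colourings (Suc n)) = fib n"
proof (induction n rule: fib.induct)
  case 1
  have "colourings (Suc 0) = {}"
    by (auto simp: colourings_def sees_both_colours_def)
  then show ?case by simp
next
  case 2
  have "A = {1}" if "A \<in> colourings (Suc (Suc 0))" for A
  proof -
    have *: "A \<subseteq> {1, 2}" "1 \<in> A" "sees_both_colours 2 A"
      using that by (auto simp: colourings_def numeral_2_eq_2 atLeastAtMostSuc_conv)
    then have "2 \<notin> A" using sees_both_colours_last(2)[OF *(3)] by simp
    with * show ?thesis by auto
  qed
  moreover have "{1} \<in> colourings (Suc (Suc 0))"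
    by (auto simp: colourings_def sees_both_colours_def)
  ultimately have "colourings (Suc (Suc 0)) = {{1}}" by blast
  then show ?case by simp
next
  case (3 n)
  then show ?case by (simp add: card_colourings_rec)
qed

lemma dp_path_graph: "dp (path_graph (Suc n)) 2 = fib n"
  by (simp add: dp_path_graph_eq_card_colourings card_colourings)

lemma fib_ratio_tendsto: "(\<lambda>n. real (fib (Suc n)) / real (fib n)) \<longlonglongrightarrow> (1 + sqrt 5) / 2"
proof -
  define \<phi> :: real where "\<phi> = (1 + sqrt 5) / 2"
  have "\<phi> > 0" by (simp add: \<phi>_def add_pos_pos)
  \<comment> \<open>Normalised by Binet's leading term, the sequence tends to 1, and \<open>\<phi>\<close> is the ratio of those terms.\<close>
  let ?q = "\<lambda>n. real (fib n) / (\<phi> ^ n / sqrt 5)"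
  have q: "?q \<longlonglongrightarrow> 1"
    using fib_asymptotics by (simp add: \<phi>_def)
  have "(\<lambda>n. \<phi> * (?q (Suc n) / ?q n)) \<longlonglongrightarrow> \<phi> * (1 / 1)"
    by (intro tendsto_intros LIMSEQ_Suc[OF q] q) simp
  moreover have "\<phi> * (?q (Suc n) / ?q n) = real (fib (Suc n)) / real (fib n)" for n
    using \<open>\<phi> > 0\<close> by (simp add: divide_simps)
  ultimately show ?thesis by (simp add: \<phi>_def)
qed

theorem corollary7p3:
  shows "(\<lambda>n. real (dp (path_graph (n + 1)) 2) / real (dp (path_graph n) 2))
           \<longlonglongrightarrow> (1 + sqrt 5) / 2"
proof (rule LIMSEQ_imp_Suc)
  show "(\<lambda>n. real (dp (path_graph (Suc n + 1)) 2) / real (dp (path_graph (Suc n)) 2))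
           \<longlonglongrightarrow> (1 + sqrt 5) / 2"
    using fib_ratio_tendsto by (simp only: dp_path_graph Suc_eq_plus1[symmetric])
qed

end
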